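(* Suppose that the following statement (Hindman's conjecture) is true: in any finite colouring of $\mathbb{N}$ there exist $x,y\in\mathbb{N}$ such that $x,\ y,\ x+y,\ xy$ all have the same colour. Then the equation $$x_1^2-x_2^2=y^2+z$$ is partition regular.
   Context: $\mathbb{N}$ denotes the positive integers. A finite colouring of $\mathbb{N}$ is a partition of $\mathbb{N}$ into finitely many parts (colours). A polynomial equation $P(x_1,\dots,x_n)=0$ is called partition regular if for any finite partition $\mathbb{N}=C_1\cup\dots\cup C_r$ there exist a part $C_j$ and infinitely many $(x_1,\dots,x_n)\in C_j^n$ such that $P(x_1,\dots,x_n)=0$. *)

theory Defs
  imports Complex_Main "HOL-Library.Disjoint_Sets"
begin

definition finite_colouring :: "nat set set \<Rightarrow> bool" where
  "finite_colouring \<C> \<longleftrightarrow> finite \<C> \<and> partition_on {1..} \<C>"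

definition hindman_conjecture :: bool where
  "hindman_conjecture \<longleftrightarrow>
     (\<forall>\<C>. finite_colouring \<C> \<longrightarrow>
        (\<exists>C\<in>\<C>. \<exists>x\<ge>1. \<exists>y\<ge>1. x \<in> C \<and> y \<in> C \<and> x + y \<in> C \<and> x * y \<in> C))"

text \<open>
  An n-tuple of natural numbers is a list of length n.  The polynomial enters through its
  evaluation function P on tuples of integers, so that subtraction is not truncated.  The
  definition does not itself demand that P be polynomial.
\<close>
definition partition_regular :: "nat \<Rightarrow> (int list \<Rightarrow> int) \<Rightarrow> bool" where
  "partition_regular n P \<longleftrightarrow>
     (\<forall>\<C>. finite_colouring \<C> \<longrightarrow>
        (\<exists>C\<in>\<C>. infinite {xs. length xs = n \<and> set xs \<subseteq> C \<and> P (map int xs) = 0}))"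

end

theory Submission
  imports Defs
begin

text \<open>
  If \<open>x\<close> and \<open>y\<close> are as in Hindman's conjecture, then \<open>(x + y)\<^sup>2 - x\<^sup>2 = y\<^sup>2 + 2 x y\<close> solves the
  equation, except that the colour of \<open>2 x y\<close> is unknown, as only that of \<open>x y\<close> is controlled.
  Halving the solution repairs this: \<open>x1 = (x + y) / 2\<close>, \<open>x2 = x / 2\<close>, \<open>y / 2\<close> and
  \<open>z = x y / 2\<close> also solve the equation, and they are the halves of the four numbers
  \<open>x + y, x, y, x y\<close>. So the conjecture is applied to the colouring of \<open>n\<close> by its parity and, for
  even \<open>n\<close>, the given colour of \<open>n / 2\<close>. Two numbers and their sum have the same parity only if
  they are even, hence all the halves are natural numbers
  (\<open>hindman_imp_monochromatic_solution\<close>).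

  Infinitely many solutions in one colour come for free because the equation has no constant
  solution: if every colour had only finitely many, the numbers occurring in them could be given
  colours of their own, and no monochromatic solution would remain
  (\<open>partition_regular_if_nonconstant_solutions\<close>).
\<close>

lemma hindman_conjecture_function:
  assumes "hindman_conjecture" and fin: "finite (f ` {1..})"
  obtains x y :: nat where "x \<ge> 1" "y \<ge> 1" "f y = f x" "f (x + y) = f x" "f (x * y) = f x"
proof -
  define \<C> where "\<C> = (\<lambda>c. {n. n \<ge> 1 \<and> f n = c}) ` (f ` {1..})"
  have "finite_colouring \<C>"
    unfolding finite_colouring_def partition_on_def disjoint_def
    using fin by (auto simp: \<C>_def)
  then obtain C x y where C: "C \<in> \<C>" and xy: "x \<ge> 1" "y \<ge> 1"
      and mem: "x \<in> C" "y \<in> C" "x + y \<in> C" "x * y \<in> C"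
    using assms(1) unfolding hindman_conjecture_def by blast
  from C obtain c where "C = {n. n \<ge> 1 \<and> f n = c}"
    by (auto simp: \<C>_def)
  with xy mem show ?thesis
    by (intro that[of x y]) auto
qed

text \<open>
  Halving turns the term \<open>2 x y\<close> of \<open>(x + y)\<^sup>2 - x\<^sup>2 = y\<^sup>2 + 2 x y\<close> into \<open>x y / 2\<close>, on a par with the
  halves of \<open>x\<close>, \<open>y\<close> and \<open>x + y\<close>; in terms of \<open>a = x / 2\<close> and \<open>b = y / 2\<close>, the solution is
  \<open>(a + b)\<^sup>2 - a\<^sup>2 = b\<^sup>2 + 2 a b\<close>.
\<close>
lemma hindman_imp_monochromatic_solution:
  assumes "hindman_conjecture" and fin: "finite (d ` {1..})"
  obtains a b :: nat where "a \<ge> 1" "b \<ge> 1" "d b = d a" "d (a + b) = d a" "d (2 * a * b) = d a"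
proof -
  define f where "f n = (if even n then Some (d (n div 2)) else None)" for n
  have "f ` {1..} \<subseteq> insert None (Some ` d ` {1..})"
  proof
    fix c assume "c \<in> f ` {1..}"
    then obtain n where n: "n \<ge> 1" "c = f n" by auto
    show "c \<in> insert None (Some ` d ` {1..})"
    proof (cases "even n")
      case True
      then have "n div 2 \<in> {1..}" using n(1) by (auto elim!: evenE)
      then show ?thesis using n(2) True by (auto simp: f_def)
    qed (use n(2) in \<open>simp add: f_def\<close>)
  qed
  then have "finite (f ` {1..})"
    using fin finite_subset by blast
  then obtain x y where xy: "x \<ge> 1" "y \<ge> 1"
      and f: "f y = f x" "f (x + y) = f x" "f (x * y) = f x"
    using hindman_conjecture_function assms(1) by metis
  have "even x" "even y"
    using f(1,2) by (auto simp: f_def split: if_splits)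
  then obtain a b where ab: "x = 2 * a" "y = 2 * b"
    by (elim evenE)
  have "(2 * a * (2 * b)) div 2 = 2 * a * b" "(2 * a + 2 * b) div 2 = a + b"
    by simp_all
  with f xy show ?thesis
    by (intro that[of a b]) (auto simp: f_def ab mult.assoc)
qed

text \<open>
  A nonconstant monochromatic solution for every finite colouring already gives infinitely many
  in one colour. Otherwise the set \<open>U\<close> of all numbers that occur in monochromatic solutions
  would be finite, and one could refine the colouring by making every element of \<open>U\<close> a colour
  class of its own. A nonconstant solution that is monochromatic for the refinement avoids \<open>U\<close>,
  contrary to the choice of \<open>U\<close>.
\<close>
lemma partition_regular_if_nonconstant_solutions:
  assumes sol: "\<And>d :: nat \<Rightarrow> nat set \<times> nat set set. finite (d ` {1..}) \<Longrightarrow>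
    \<exists>xs. length xs = n \<and> set xs \<subseteq> {1..} \<and> P (map int xs) = 0 \<and>
      (\<forall>a\<in>set xs. \<forall>b\<in>set xs. d a = d b) \<and> (\<exists>a\<in>set xs. \<exists>b\<in>set xs. a \<noteq> b)"
  shows "partition_regular n P"
  unfolding partition_regular_def
proof (intro allI impI)
  fix \<C> assume col: "finite_colouring \<C>"
  define S where "S C = {xs. length xs = n \<and> set xs \<subseteq> C \<and> P (map int xs) = 0}" for C
  have "\<exists>C\<in>\<C>. infinite (S C)"
  proof (rule ccontr)
    assume "\<not> (\<exists>C\<in>\<C>. infinite (S C))"
    moreover define U where "U = (\<Union>C\<in>\<C>. \<Union>xs\<in>S C. set xs)"
    ultimately have "finite U"
      using col by (auto simp: finite_colouring_def)
    define d where "d m = ({m} \<inter> U, {C\<in>\<C>. m \<in> C})" for m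
    have "d ` {1..} \<subseteq> Pow U \<times> Pow \<C>"
      by (auto simp: d_def)
    then have "finite (d ` {1..})"
      by (rule finite_subset) (use \<open>finite U\<close> col in \<open>simp add: finite_colouring_def\<close>)
    then obtain xs a b where xs: "length xs = n" "set xs \<subseteq> {1..}" "P (map int xs) = 0"
        and mono: "\<forall>a\<in>set xs. \<forall>b\<in>set xs. d a = d b"
        and ab: "a \<in> set xs" "b \<in> set xs" "a \<noteq> b"
      using sol by metis
    have "a \<in> \<Union>\<C>"
      using xs(2) ab(1) col by (auto simp: finite_colouring_def partition_on_def)
    then obtain C where C: "C \<in> \<C>" "a \<in> C" by blast
    have "set xs \<subseteq> C"
      using mono ab(1) C by (auto simp: d_def)
    with xs have "xs \<in> S C" by (simp add: S_def)
    with C(1) ab(1) have "a \<in> U" by (auto simp: U_def)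
    moreover have "d a = d b" using mono ab by blast
    ultimately show False
      using ab(3) by (auto simp: d_def)
  qed
  then show "\<exists>C\<in>\<C>. infinite {xs. length xs = n \<and> set xs \<subseteq> C \<and> P (map int xs) = 0}"
    by (simp add: S_def)
qed

theorem theorem1p13:
  assumes "hindman_conjecture"
  shows "partition_regular 4
    (\<lambda>v. let x1 = v ! 0; x2 = v ! 1; y = v ! 2; z = v ! 3 in (x1\<^sup>2 - x2\<^sup>2) - (y\<^sup>2 + z))"
proof (rule partition_regular_if_nonconstant_solutions, goal_cases)
  case (1 d)
  obtain a b where ab: "a \<ge> 1" "b \<ge> 1" "d b = d a" "d (a + b) = d a" "d (2 * a * b) = d a"
    using hindman_imp_monochromatic_solution[OF assms 1] .
  show ?case
    by (rule exI[of _ "[a + b, a, b, 2 * a * b]"])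
       (use ab in \<open>auto simp: Let_def power2_eq_square algebra_simps\<close>)
qed

end
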